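(* Let $b_k$ be a particle belief, $a_k$ an action, $\pi$ a policy, and let $\tau^i=(b^i_{k_i},a^i_{k_i})\rightarrow\tau^i_{suffix}$ be a trajectory of horizon $d$ with $$\tau^i_{suffix}=(b^{-i}_{k_i+1},o^i_{k_i+1},b^i_{k_i+1},a^i_{k_i+1})\rightarrow\cdots\rightarrow(b^{-i}_{k_i+d},o^i_{k_i+d},b^i_{k_i+d}),$$ such that $\mathbb{P}(\tau^i_{suffix}\mid b^i_{k_i},a^i_{k_i},\pi)>0$. Then $$\frac{\mathbb{P}(\tau^i_{suffix}\mid b_k,a_k,\pi)}{\mathbb{P}(\tau^i_{suffix}\mid b^i_{k_i},a^i_{k_i},\pi)}=\frac{\mathbb{P}(b^{-i}_{k_i+1}\mid b_k,a_k)}{\mathbb{P}(b^{-i}_{k_i+1}\mid b^i_{k_i},a^i_{k_i})}.$$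
   Context: Setting: a POMDP with state, action and observation spaces $S,A,O$ (possibly continuous), state transition density $\mathbb{P}_T(s'\mid s,a)$ and observation density $\mathbb{P}_O(o\mid s)$. Beliefs are represented by $m$ equally weighted, ordered particles: $b=\{s^j,\tfrac1m\}_{j=1}^m$ (different orderings are different beliefs). Particle filter step with resampling: from a belief $b$ and action $a$, each particle is propagated through the transition model, giving the propagated belief $b^-=\{s^{-j},\tfrac1m\}_{j=1}^m$, with likelihood $$\mathbb{P}(b^-\mid b,a)=\frac1m\prod_{j=1}^m\mathbb{P}_T(s^{-j}\mid s^j,a).$$ Then an observation $o$ is generated with likelihood $\mathbb{P}(o\mid b^-)$ depending only on the propagated belief, and the posterior belief $b'$ is obtained by reweighting the particles of $b^-$ by $\mathbb{P}_O(o\mid\cdot)$ and resampling, with likelihood $\mathbb{P}(b'\mid b^-,o)$ depending only on $b^-$ and $o$. A policy $\pi$ maps beliefs to actions (it may be a sequence of such maps indexed by the step along the trajectory). Write $\pi(a\mid b)$ for the likelihood that it selects $a$ at $b$; for a step-indexed policy the map for the corresponding step is used. A trajectory starts at a pair $(b,a)$ and alternates particle filter steps and action selection by $\pi$ for $d$ steps. The part after the initial pair is the suffix $(b^-_1,o_1,b_1,a_1)\to\cdots\to(b^-_d,o_d,b_d)$. $\mathbb{P}(\tau_{suffix}\mid b,a,\pi)$ denotes the joint likelihood (density with respect to a reference measure that does not depend on the initial pair) of the suffix when the initial belief and action are $(b,a)$, i.e., with $b_0:=b$, $a_0:=a$, the product over $t=1,\dots,d$ of $\mathbb{P}(b^-_t\mid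 b_{t-1},a_{t-1})\,\mathbb{P}(o_t\mid b^-_t)\,\mathbb{P}(b_t\mid b^-_t,o_t)$ and over $t=1,\dots,d-1$ of $\pi(a_t\mid b_t)$. In $\mathbb{P}(\tau^i_{suffix}\mid b_k,a_k,\pi)$ the same suffix is evaluated with the initial pair $(b_k,a_k)$ in place of $(b^i_{k_i},a^i_{k_i})$, the same policy acting at the same steps of the suffix. *)

theory Defs
  imports "HOL-Probability.Probability"
begin

definition prob_density :: "'x measure \<Rightarrow> ('x \<Rightarrow> real) \<Rightarrow> bool" where
  "prob_density R f \<longleftrightarrow>
     f \<in> borel_measurable R \<and> (\<forall>x\<in>space R. 0 \<le> f x) \<and>
     prob_space (density R (\<lambda>x. ennreal (f x)))"

(* A particle belief {(s^j, 1/m)}_{j=1..m} is the list of its m states; the equal weights are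
   implicit, and lists distinguish different orderings of the same particles. *)
type_synonym 's belief = "'s list"

(* Conditional densities take the conditioning arguments first:
     trans_dens M s a s'       is  P_T(s' | s, a)
     obs_dens M s z            is  P_O(z | s)
     obs_lik M bm z            is  P(z | bm)
     resample_lik M w b'       is  the likelihood of resampling the weighted particles w to b'
   state_ref and obs_ref are the reference measures of the state and observation densities; their
   underlying sets are the state and observation spaces.  The reference measure of the resampling
   law may depend on the weighted particles, so that discrete resampling (counting measure) is
   covered as well as resampling that has a continuous density. *)
record ('s, 'a, 'o) particle_pomdp =
  state_ref :: "'s measure"
  actions :: "'a set"
  obs_ref :: "'o measure"
  trans_dens :: "'s \<Rightarrow> 'a \<Rightarrow> 's \<Rightarrow> real"
  obs_dens :: "'s \<Rightarrow> 'o \<Rightarrow> real"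
  num_particles :: nat
  obs_lik :: "'s belief \<Rightarrow> 'o \<Rightarrow> real"
  resample_ref :: "('s \<times> real) list \<Rightarrow> 's belief measure"
  resample_lik :: "('s \<times> real) list \<Rightarrow> 's belief \<Rightarrow> real"

definition beliefs :: "('s, 'a, 'o) particle_pomdp \<Rightarrow> 's belief set" where
  "beliefs M = {b. length b = num_particles M \<and> set b \<subseteq> space (state_ref M)}"

(* Unnormalised weights: a resampling scheme may normalise them itself. *)
definition reweight :: "('s, 'a, 'o) particle_pomdp \<Rightarrow> 's belief \<Rightarrow> 'o \<Rightarrow> ('s \<times> real) list" where
  "reweight M bm z = map (\<lambda>s. (s, 1 / real (num_particles M) * obs_dens M s z)) bm"

(* Nothing is required of the resampling law when all weights vanish. *)
locale particle_filter =
  fixes M :: "('s, 'a, 'o) particle_pomdp"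
  assumes num_particles_pos: "num_particles M \<ge> 1"
    and trans_density:
      "\<And>s a. s \<in> space (state_ref M) \<Longrightarrow> a \<in> actions M \<Longrightarrow>
         prob_density (state_ref M) (trans_dens M s a)"
    and obs_density:
      "\<And>s. s \<in> space (state_ref M) \<Longrightarrow> prob_density (obs_ref M) (obs_dens M s)"
    and obs_lik_density:
      "\<And>bm. bm \<in> beliefs M \<Longrightarrow> prob_density (obs_ref M) (obs_lik M bm)"
    and resample_density:
      "\<And>bm z. bm \<in> beliefs M \<Longrightarrow> z \<in> space (obs_ref M) \<Longrightarrow> (\<exists>s\<in>set bm. obs_dens M s z > 0) \<Longrightarrow>
         space (resample_ref M (reweight M bm z)) = beliefs M \<and>
         prob_density (resample_ref M (reweight M bm z)) (resample_lik M (reweight M bm z))"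

definition propagate_lik :: "('s, 'a, 'o) particle_pomdp \<Rightarrow> 's belief \<Rightarrow> 'a \<Rightarrow> 's belief \<Rightarrow> real" where
  "propagate_lik M b a bm =
     1 / real (num_particles M) * (\<Prod>j<num_particles M. trans_dens M (b ! j) a (bm ! j))"

definition posterior_lik :: "('s, 'a, 'o) particle_pomdp \<Rightarrow> 's belief \<Rightarrow> 'o \<Rightarrow> 's belief \<Rightarrow> real" where
  "posterior_lik M bm z b' = resample_lik M (reweight M bm z) b'"

(* pol t b a is the likelihood pi(a | b) of the map used at step t, a density with respect to
   Ract t b; a deterministic map g is the case pol t b = indicator {g b} with
   Ract t b = count_space (actions M). *)
definition is_policy ::
  "('s, 'a, 'o) particle_pomdp \<Rightarrow> (nat \<Rightarrow> 's belief \<Rightarrow> 'a measure) \<Rightarrow>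
   (nat \<Rightarrow> 's belief \<Rightarrow> 'a \<Rightarrow> real) \<Rightarrow> bool" where
  "is_policy M Ract pol \<longleftrightarrow>
     (\<forall>t. \<forall>b\<in>beliefs M. space (Ract t b) = actions M \<and> prob_density (Ract t b) (pol t b))"

(* A suffix (b^-_1, o_1, b_1, a_1), ..., (b^-_d, o_d, b_d) of horizon d is given by sequences
   indexed by the step t = 1, ..., d (actions: t = 1, ..., d - 1); other entries are irrelevant. *)
record ('s, 'a, 'o) suffix =
  propagated :: "nat \<Rightarrow> 's belief"
  observation :: "nat \<Rightarrow> 'o"
  posterior :: "nat \<Rightarrow> 's belief"
  action :: "nat \<Rightarrow> 'a"

definition is_suffix :: "('s, 'a, 'o) particle_pomdp \<Rightarrow> nat \<Rightarrow> ('s, 'a, 'o) suffix \<Rightarrow> bool" where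
  "is_suffix M d \<tau> \<longleftrightarrow>
     (\<forall>t\<in>{1..d}. propagated \<tau> t \<in> beliefs M \<and> observation \<tau> t \<in> space (obs_ref M) \<and>
        posterior \<tau> t \<in> beliefs M) \<and>
     (\<forall>t\<in>{1..<d}. action \<tau> t \<in> actions M)"

definition suffix_lik ::
  "('s, 'a, 'o) particle_pomdp \<Rightarrow> nat \<Rightarrow> ('s, 'a, 'o) suffix \<Rightarrow> 's belief \<Rightarrow> 'a \<Rightarrow>
   (nat \<Rightarrow> 's belief \<Rightarrow> 'a \<Rightarrow> real) \<Rightarrow> real" where
  "suffix_lik M d \<tau> b a pol =
     (let bs = (posterior \<tau>)(0 := b); as = (action \<tau>)(0 := a) in
       (\<Prod>t=1..d. propagate_lik M (bs (t - 1)) (as (t - 1)) (propagated \<tau> t) *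
                  obs_lik M (propagated \<tau> t) (observation \<tau> t) *
                  posterior_lik M (propagated \<tau> t) (observation \<tau> t) (bs t)) *
       (\<Prod>t=1..<d. pol t (bs t) (as t)))"

end

theory Submission imports Defs begin

text \<open>The initial pair \<open>(b, a)\<close> enters the likelihood of a suffix only through its first propagation
  factor. Everything else is a common factor, nonzero by positivity, and cancels in the ratio.\<close>

text \<open>\<open>C\<close> is chosen before \<open>b\<close> and \<open>a\<close>, so one and the
  same factor serves both initial pairs of the ratio.\<close>

lemma suffix_lik_factor:
  assumes "d \<ge> 1"
  obtains C where "\<And>b a. suffix_lik M d \<tau> b a pol = propagate_lik M b a (propagated \<tau> 1) * C"
proof
  fix b a
  \<comment> \<open>\<open>?ol\<close>, \<open>?g\<close> and \<open>?p\<close> read the fields of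
    \<open>\<tau>\<close> without the updates at 0. They are thus free of \<open>b\<close> and
    \<open>a\<close> and may form the witness for \<open>C\<close>.\<close>
  let ?ol = "\<lambda>t. obs_lik M (propagated \<tau> t) (observation \<tau> t) *
                  posterior_lik M (propagated \<tau> t) (observation \<tau> t) (posterior \<tau> t)"
  let ?g = "\<lambda>t. propagate_lik M (posterior \<tau> (t - 1)) (action \<tau> (t - 1)) (propagated \<tau> t) * ?ol t"
  let ?p = "\<Prod>t=1..<d. pol t (posterior \<tau> t) (action \<tau> t)"
  let ?f = "\<lambda>t. propagate_lik M (((posterior \<tau>)(0 := b)) (t - 1)) (((action \<tau>)(0 := a)) (t - 1)) (propagated \<tau> t) *
                  obs_lik M (propagated \<tau> t) (observation \<tau> t) *
                  posterior_lik M (propagated \<tau> t) (observation \<tau> t) (((posterior \<tau>)(0 := b)) t)"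
  \<comment> \<open>Only \<open>t = 1\<close> looks up index \<open>t - 1 = 0\<close>, where the
    initial pair is stored. For \<open>d = 1\<close> the remaining product is empty.\<close>
  have "prod ?f {1..d} = ?f 1 * prod ?f {2..d}"
    using assms by (simp add: prod.atLeast_Suc_atMost numeral_2_eq_2)
  \<comment> \<open>From \<open>t = 2\<close> on, both \<open>t\<close> and \<open>t - 1\<close> are
    positive, so the updates at 0 are not seen.\<close>
  also have "prod ?f {2..d} = prod ?g {2..d}"
    by (intro prod.cong) auto
  finally have "prod ?f {1..d} = propagate_lik M b a (propagated \<tau> 1) * (?ol 1 * prod ?g {2..d})"
    by simp
  moreover have "(\<Prod>t=1..<d. pol t (((posterior \<tau>)(0 := b)) t) (((action \<tau>)(0 := a)) t)) = ?p"
    by (intro prod.cong) auto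
  ultimately show "suffix_lik M d \<tau> b a pol =
      propagate_lik M b a (propagated \<tau> 1) * (?ol 1 * prod ?g {2..d} * ?p)"
    by (simp only: suffix_lik_def Let_def mult.assoc)
qed

theorem theorem2:
  fixes M :: "('s, 'a, 'o) particle_pomdp"
    and Ract :: "nat \<Rightarrow> 's belief \<Rightarrow> 'a measure"
    and pol :: "nat \<Rightarrow> 's belief \<Rightarrow> 'a \<Rightarrow> real"
    and d :: nat
    and \<tau> :: "('s, 'a, 'o) suffix"
    and bk bi :: "'s belief" and ak ai :: 'a
  assumes "particle_filter M"
    and "is_policy M Ract pol"
    and "bk \<in> beliefs M" and "ak \<in> actions M"
    and "bi \<in> beliefs M" and "ai \<in> actions M"
    and "d \<ge> 1" and "is_suffix M d \<tau>"
    and "suffix_lik M d \<tau> bi ai pol > 0"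
  shows "suffix_lik M d \<tau> bk ak pol / suffix_lik M d \<tau> bi ai pol =
         propagate_lik M bk ak (propagated \<tau> 1) / propagate_lik M bi ai (propagated \<tau> 1)"
proof -
  obtain C where C: "\<And>b a. suffix_lik M d \<tau> b a pol = propagate_lik M b a (propagated \<tau> 1) * C"
    using suffix_lik_factor \<open>d \<ge> 1\<close> by blast
  \<comment> \<open>\<open>C\<close> divides the positive likelihood from \<open>(bi, ai)\<close>,
    so it cannot vanish and may be cancelled.\<close>
  have "C \<noteq> 0"
    using \<open>suffix_lik M d \<tau> bi ai pol > 0\<close> by (auto simp: C)
  then show ?thesis
    by (simp add: C)
qed

end
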